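(* Let $K$ be a field, $n\ge1$, and $R=R(K[X_1,\ldots,X_n])$. Then $R$ is atomic; that is, every nonzero nonunit element of $R$ factors into a product of irreducible elements.
   Context: For an integral domain $T$, the reciprocal complement $R(T)$ is the subring of the fraction field of $T$ generated by all $1/f$ with $f\in T\setminus\{0\}$. Here $K[X_1,\ldots,X_n]$ is the polynomial ring in $n$ variables over $K$. *)

theory Defs
  imports
    "HOL-Algebra.Algebra"
    "HOL-Algebra.Algebraic_Closure_Type"
    "HOL-Computational_Algebra.Fraction_Field"
    "HOL-Library.Poly_Mapping"
begin

text \<open>
  Monomials are finitely supported exponent functions \<open>'n \<Rightarrow>\<^sub>0 nat\<close> and polynomials are finitely
  supported functions from monomials to coefficients, multiplied by convolution. For a finite
  index type \<open>'n\<close> with \<open>n\<close> elements this is the polynomial ring in \<open>n\<close> variables over \<open>'k\<close>. Its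
  instance of class \<open>idom\<close> requires a linear order on \<open>'n\<close>; the ring itself does not depend on it.
\<close>
type_synonym ('n, 'k) mpoly = "('n \<Rightarrow>\<^sub>0 nat) \<Rightarrow>\<^sub>0 'k"

text \<open>
  The integral domain \<open>T\<close> is the type \<open>'a\<close> and its fraction field is the type \<open>'a fract\<close>.
\<close>
definition reciprocal_complement :: "'a::idom fract ring" where
  "reciprocal_complement =
     ring_of_type_algebra
       \<lparr>carrier := generate_ring ring_of_type_algebra {1 / Fract f 1 | f :: 'a. f \<noteq> 0}\<rparr>"

text \<open>
  The list of factors of a nonunit is automatically nonempty, since the empty product is \<open>\<one>\<close>.
\<close>
definition atomic :: "('a, 'b) ring_scheme \<Rightarrow> bool" where
  "atomic R \<longleftrightarrow>
     (\<forall>a \<in> carrier R. a \<noteq> \<zero>\<^bsub>R\<^esub> \<and> a \<notin> Units R \<longrightarrow>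
        (\<exists>fs. set fs \<subseteq> carrier R \<and> (\<forall>f \<in> set fs. ring_irreducible\<^bsub>R\<^esub> f) \<and>
              foldr (\<otimes>\<^bsub>R\<^esub>) fs \<one>\<^bsub>R\<^esub> = a))"

end

theory Submission
  imports Defs "HOL-Computational_Algebra.Polynomial_Factorial"
begin

text \<open>
  Write \<open>R\<close> for the reciprocal complement of a domain \<open>D\<close>. Since \<open>(1 / f) (1 / g) = 1 / (f g)\<close>,
  its elements are just the finite sums of reciprocals of nonzero elements of \<open>D\<close>. Suppose
  that \<open>D\<close> has a degree for which \<open>deg (f g) = deg f + deg g\<close> if \<open>f, g \<noteq> 0\<close>, \<open>deg (f + g) \<le> max (deg f) (deg g)\<close>
  and the nonzero elements of degree \<open>0\<close> are units, as polynomials over a field do. Then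
  \<open>v (a / b) = deg b - deg a\<close> is a discrete valuation of the fraction field that is nonnegative
  on \<open>R\<close>. If every nonzero nonunit of \<open>R\<close> has \<open>v \<ge> 1\<close>, then a nonzero \<open>x\<close> in \<open>R\<close> is a product of at
  most \<open>v x\<close> nonunits, so splitting it further and further stops at irreducible factors.

  What has to be shown is therefore that the elements of \<open>R\<close> of valuation \<open>0\<close> are units. Such an
  element is \<open>x = c + 1 / f\<^sub>1 + \<dots> + 1 / f\<^sub>k\<close> with \<open>c\<close> a unit of \<open>D\<close> and all \<open>f\<^sub>i\<close> of positive degree. If
  it lay in a maximal ideal \<open>M\<close>, then so would the shorter sum that is left after dropping all
  \<open>1 / f\<^sub>i\<close> that lie in \<open>M\<close>. That sum is \<open>q / p\<close>, where \<open>p\<close> is the product of the remaining \<open>f\<^sub>i\<close> and \<open>q\<close>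
  is nonzero, having the same degree as \<open>p\<close>. Multiplying by \<open>1 / q\<close> gives \<open>1 / p\<close> in \<open>M\<close>, although \<open>M\<close>
  is prime and contains no reciprocal of a remaining \<open>f\<^sub>i\<close>. The lemma
  \<open>reciprocal_of_sum_localized\<close> turns this argument into an induction on \<open>k\<close> that needs no prime
  ideals: instead of deciding whether \<open>1 / f\<^sub>k\<close> lies in \<open>M\<close>, it treats both cases and glues them.
\<close>

section \<open>The reciprocal complement as the set of sums of unit fractions\<close>

definition unit_fraction_sums :: "'a::idom fract set" where
  "unit_fraction_sums = {\<Sum>f\<leftarrow>fs. 1 / to_fract f | fs. 0 \<notin> set fs}"

lemma unit_fraction_sumsE:
  assumes "x \<in> unit_fraction_sums"
  obtains fs where "0 \<notin> set fs" "x = (\<Sum>f\<leftarrow>fs. 1 / to_fract f)"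
  using assms by (auto simp: unit_fraction_sums_def)

lemma unit_fraction_sumsI:
  "0 \<notin> set fs \<Longrightarrow> (\<Sum>f\<leftarrow>fs. 1 / to_fract f) \<in> unit_fraction_sums"
  by (auto simp: unit_fraction_sums_def)

lemma zero_in_sums [simp]: "0 \<in> unit_fraction_sums"
  using unit_fraction_sumsI[of "[]"] by simp

lemma reciprocal_in_sums: "f \<noteq> 0 \<Longrightarrow> 1 / to_fract f \<in> unit_fraction_sums"
  using unit_fraction_sumsI[of "[f]"] by simp

lemma one_in_sums [simp]: "1 \<in> unit_fraction_sums"
  using reciprocal_in_sums[of 1] by simp

lemma add_in_sums:
  assumes "x \<in> unit_fraction_sums" "y \<in> unit_fraction_sums"
  shows "x + y \<in> unit_fraction_sums"
proof -
  obtain fs gs where "0 \<notin> set fs" "0 \<notin> set gs"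
    and "x = (\<Sum>f\<leftarrow>fs. 1 / to_fract f)" "y = (\<Sum>g\<leftarrow>gs. 1 / to_fract g)"
    using assms by (metis unit_fraction_sumsE)
  then show ?thesis
    using unit_fraction_sumsI[of "fs @ gs"] by simp
qed

lemma uminus_in_sums:
  assumes "x \<in> unit_fraction_sums"
  shows "- x \<in> unit_fraction_sums"
proof -
  obtain fs where fs: "0 \<notin> set fs" "x = (\<Sum>f\<leftarrow>fs. 1 / to_fract f)"
    using assms by (rule unit_fraction_sumsE)
  have "- x = (\<Sum>f\<leftarrow>map uminus fs. 1 / to_fract f)"
    unfolding fs(2) by (induction fs) auto
  moreover have "0 \<notin> set (map uminus fs)"
    using fs(1) by auto
  ultimately show ?thesis
    using unit_fraction_sumsI by metis
qed

lemma diff_in_sums: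
  "\<lbrakk>x \<in> unit_fraction_sums; y \<in> unit_fraction_sums\<rbrakk> \<Longrightarrow> x - y \<in> unit_fraction_sums"
  using add_in_sums[OF _ uminus_in_sums, of x y] by simp

lemma mult_reciprocal_in_sums:
  assumes "x \<in> unit_fraction_sums" "g \<noteq> 0"
  shows "x * (1 / to_fract g) \<in> unit_fraction_sums"
proof -
  obtain fs where fs: "0 \<notin> set fs" "x = (\<Sum>f\<leftarrow>fs. 1 / to_fract f)"
    using assms(1) by (rule unit_fraction_sumsE)
  have "x * (1 / to_fract g) = (\<Sum>f\<leftarrow>map (\<lambda>f. f * g) fs. 1 / to_fract f)"
    unfolding fs(2) by (induction fs) (auto simp: algebra_simps add_divide_distrib)
  moreover have "0 \<notin> set (map (\<lambda>f. f * g) fs)"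
    using fs(1) assms(2) by auto
  ultimately show ?thesis
    using unit_fraction_sumsI by metis
qed

lemma mult_in_sums:
  assumes "x \<in> unit_fraction_sums" "y \<in> unit_fraction_sums"
  shows "x * y \<in> unit_fraction_sums"
proof -
  obtain gs where "0 \<notin> set gs" "y = (\<Sum>g\<leftarrow>gs. 1 / to_fract g)"
    using assms(2) by (rule unit_fraction_sumsE)
  then show ?thesis
  proof (induction gs arbitrary: y)
    case (Cons g gs)
    then show ?case
      using add_in_sums mult_reciprocal_in_sums[OF assms(1), of g]
      by (simp add: distrib_left del: times_divide_eq_right mult_1_right)
  qed simp
qed

lemma power_in_sums: "x \<in> unit_fraction_sums \<Longrightarrow> x ^ n \<in> unit_fraction_sums"
  by (induction n) (auto intro: mult_in_sums)

lemmas in_sums = add_in_sums uminus_in_sums diff_in_sums mult_in_sums power_in_sums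

lemma uminus_ring_of_type_algebra:
  "\<ominus>\<^bsub>ring_of_type_algebra\<^esub> x = - (x :: 'a::comm_ring_1)"
proof -
  interpret cring "ring_of_type_algebra :: 'a ring"
    by (rule cring_from_type_algebra)
  show ?thesis
    by (rule minus_equality) (simp_all add: ring_of_type_algebra_def)
qed

text \<open>
  This replaces the inductively generated subring by a set whose members can be taken apart into
  a list of denominators, which is what the inductions below run over.
\<close>
lemma generate_ring_reciprocals:
  "generate_ring ring_of_type_algebra {1 / Fract f 1 | f :: 'a::idom. f \<noteq> 0} = unit_fraction_sums"
  (is "?G = _")
proof
  show "?G \<subseteq> unit_fraction_sums"
  proof
    fix x assume "x \<in> ?G"
    then show "x \<in> unit_fraction_sums"
    proof induction
      case (incl h)
      then show ?case
        using reciprocal_in_sums by (auto simp: to_fract_def)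
    next
      case (a_inv h)
      then show ?case
        by (simp add: uminus_ring_of_type_algebra uminus_in_sums)
    qed (simp_all add: ring_of_type_algebra_def in_sums)
  qed
  have zero: "0 \<in> ?G"
    using generate_ring.eng_add[OF generate_ring.one generate_ring.a_inv[OF generate_ring.one],
        of "ring_of_type_algebra :: 'a fract ring"]
    unfolding uminus_ring_of_type_algebra by (simp add: ring_of_type_algebra_def)
  have "(\<Sum>f\<leftarrow>fs. 1 / to_fract f) \<in> ?G" if "0 \<notin> set fs" for fs
    using that
  proof (induction fs)
    case (Cons f fs)
    then have "1 / to_fract f \<in> ?G"
      by (intro generate_ring.incl) (auto simp: to_fract_def)
    from generate_ring.eng_add[OF this Cons.IH] Cons.prems show ?case
      by (simp add: ring_of_type_algebra_def)
  qed (simp add: zero)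
  then show "unit_fraction_sums \<subseteq> ?G"
    by (auto elim!: unit_fraction_sumsE)
qed

lemma reciprocal_complement_simps [simp]:
  "carrier (reciprocal_complement :: 'a::idom fract ring) = unit_fraction_sums"
  "\<one>\<^bsub>reciprocal_complement :: 'a fract ring\<^esub> = 1"
  "\<zero>\<^bsub>reciprocal_complement :: 'a fract ring\<^esub> = 0"
  "(\<otimes>\<^bsub>reciprocal_complement :: 'a fract ring\<^esub>) = (*)"
  unfolding reciprocal_complement_def generate_ring_reciprocals
  by (simp_all add: ring_of_type_algebra_def)

lemma Units_reciprocal_complement:
  "Units (reciprocal_complement :: 'a::idom fract ring) =
    {x \<in> unit_fraction_sums. x \<noteq> 0 \<and> 1 / x \<in> unit_fraction_sums}"
proof -
  have "y * x = 1 \<and> x * y = 1 \<longleftrightarrow> x \<noteq> 0 \<and> y = 1 / x" for x y :: "'a fract"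
    by (cases "x = 0") (auto simp: nonzero_eq_divide_eq mult.commute)
  then show ?thesis
    by (auto simp: Units_def)
qed


section \<open>Domains with a degree\<close>

text \<open>
  The axioms also fix \<open>deg 0 = 0\<close>, since \<open>deg (1 + (- 1)) \<le> 0\<close>; strict inequalities between degrees
  are therefore only meaningful together with nonvanishing conditions.
\<close>
locale degree_function =
  fixes deg :: "'a::idom \<Rightarrow> nat"
  assumes deg_mult: "\<lbrakk>f \<noteq> 0; g \<noteq> 0\<rbrakk> \<Longrightarrow> deg (f * g) = deg f + deg g"
    and deg_add_le: "deg (f + g) \<le> max (deg f) (deg g)"
    and deg_0_imp_unit: "\<lbrakk>f \<noteq> 0; deg f = 0\<rbrakk> \<Longrightarrow> f dvd 1"
begin

lemma deg_1 [simp]: "deg 1 = 0"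
  using deg_mult[of 1 1] by simp

lemma deg_uminus [simp]: "deg (- f) = deg f"
proof (cases "f = 0")
  case False
  have "deg (- 1) = 0"
    using deg_mult[of "- 1" "- 1"] by simp
  then show ?thesis
    using deg_mult[of "- 1" f] False by simp
qed simp

lemma deg_add_eq:
  assumes "deg g < deg f"
  shows "deg (f + g) = deg f"
  using deg_add_le[of f g] deg_add_le[of "f + g" "- g"] assms by auto

lemma sum_units_deg_0:
  assumes "0 \<notin> set fs" "\<forall>f\<in>set fs. deg f = 0"
  obtains c where "(\<Sum>f\<leftarrow>fs. 1 / to_fract f) = to_fract c" "deg c = 0"
proof -
  have "\<exists>c. (\<Sum>f\<leftarrow>fs. 1 / to_fract f) = to_fract c \<and> deg c = 0"
    using assms
  proof (induction fs)
    case Nil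
    have "deg 0 = 0"
      using deg_add_le[of 1 "- 1"] by simp
    then show ?case
      by (intro exI[of _ 0]) simp
  next
    case (Cons f fs)
    then obtain c where c: "(\<Sum>f\<leftarrow>fs. 1 / to_fract f) = to_fract c" "deg c = 0"
      by auto
    obtain g where g: "1 = f * g"
      using deg_0_imp_unit[of f] Cons.prems by (auto elim: dvdE)
    then have "g \<noteq> 0" "f \<noteq> 0" by auto
    then have "deg g = 0"
      using deg_mult[of f g] g by simp
    have "1 / to_fract f = to_fract g"
      using \<open>f \<noteq> 0\<close> g by (simp add: field_simps flip: to_fract_mult)
    moreover have "deg (g + c) = 0"
      using deg_add_le[of g c] c(2) \<open>deg g = 0\<close> by simp
    ultimately show ?case
      using c(1) by (intro exI[of _ "g + c"]) simp
  qed
  then show ?thesis using that by blast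
qed

text \<open>
  For \<open>p = 1\<close> this says that \<open>c + 1 / f\<^sub>1 + \<dots> + 1 / f\<^sub>k\<close>, with \<open>c \<noteq> 0\<close> of degree \<open>0\<close>, is a unit of the
  reciprocal complement \<open>R\<close>. The induction on \<open>k\<close> needs the general form, where the inverse \<open>1 / x\<close> is
  only claimed to lie in the localization \<open>R[p]\<close> that makes \<open>1 / p\<close> a unit. The degree condition keeps
  the leading fraction \<open>q / p\<close> nonzero however many summands are absorbed into it.

  Let \<open>f\<close> be the first denominator and \<open>y = x - 1 / f\<close>. Absorbing \<open>1 / f\<close> into \<open>q / p\<close>, the induction
  hypothesis puts \<open>1 / x\<close> into \<open>R[p f]\<close>; so a power of \<open>1 / f\<close> is a multiple of \<open>x\<close> in \<open>R[p]\<close>. Omitting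
  \<open>1 / f\<close>, it makes \<open>y\<close> a unit of \<open>R[p]\<close>. But \<open>1 / f\<close> is congruent to \<open>- y\<close> modulo \<open>x\<close>, so the ideal of
  \<open>R[p]\<close> generated by \<open>x\<close> contains a power of a unit.
\<close>
lemma reciprocal_of_sum_localized:
  assumes "p \<noteq> 0" "q \<noteq> 0" "deg p = deg q"
    and "to_fract q / to_fract p \<in> unit_fraction_sums"
    and "\<forall>f\<in>set fs. 0 < deg f" "0 \<notin> set fs"
  defines "x \<equiv> to_fract q / to_fract p + (\<Sum>f\<leftarrow>fs. 1 / to_fract f)"
  shows "x \<noteq> 0 \<and> (\<exists>n. 1 / (to_fract p ^ n * x) \<in> unit_fraction_sums)"
  using assms(1-6) unfolding x_def
proof (induction fs arbitrary: p q)
  case Nil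
  then have "1 / (to_fract p ^ 1 * (to_fract q / to_fract p)) \<in> unit_fraction_sums"
    using reciprocal_in_sums[of q] by simp
  then have "\<exists>n. 1 / (to_fract p ^ n * (to_fract q / to_fract p)) \<in> unit_fraction_sums"
    by blast
  with Nil.prems show ?case by simp
next
  case (Cons f fs p q)
  have f: "f \<noteq> 0" "0 < deg f" and fs: "\<forall>f\<in>set fs. 0 < deg f" "0 \<notin> set fs"
    using Cons.prems by auto
  let ?p = "to_fract p" and ?f = "to_fract f" and ?R = unit_fraction_sums
  define y where "y = to_fract q / ?p + (\<Sum>f\<leftarrow>fs. 1 / to_fract f)"
  define x where "x = y + 1 / ?f"
  have y: "y \<in> ?R"
    unfolding y_def using Cons.prems fs by (intro in_sums unit_fraction_sumsI)
  then have x: "x \<in> ?R"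
    unfolding x_def using f by (intro in_sums reciprocal_in_sums)
  have "deg p < deg (q * f)"
    using Cons.prems f by (simp add: deg_mult)
  then have deg: "deg (q * f + p) = deg (p * f)"
    using deg_add_eq[of p "q * f"] Cons.prems f by (simp add: deg_mult)
  moreover have "deg (p * f) > 0" using f Cons.prems by (simp add: deg_mult)
  ultimately have "q * f + p \<noteq> 0"
    using deg_add_le[of 1 "-1"] by auto
  moreover have frac: "to_fract (q * f + p) / to_fract (p * f) = to_fract q / ?p + 1 / ?f"
    using Cons.prems f by (simp add: field_simps)
  ultimately have "x \<noteq> 0 \<and> (\<exists>n. 1 / ((?p * ?f) ^ n * x) \<in> ?R)"
    using Cons.IH[of "p * f" "q * f + p"] Cons.prems f deg fs
    by (simp add: x_def y_def add_ac in_sums reciprocal_in_sums)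
  then obtain n where x0: "x \<noteq> 0" and n: "1 / ((?p * ?f) ^ n * x) \<in> ?R"
    by blast
  obtain m where y0: "y \<noteq> 0" and m: "1 / (?p ^ m * y) \<in> ?R"
    using Cons.IH[of p q] Cons.prems fs unfolding y_def by auto
  have pR: "(1 / ?p) ^ n \<in> ?R"
    using Cons.prems by (intro in_sums reciprocal_in_sums)
  \<comment> \<open>With \<open>1 / f = x - y\<close>, the power \<open>(1 / f) ^ n\<close> may be replaced by \<open>(- y) ^ n\<close> modulo \<open>x\<close>.\<close>
  have "(x - y) ^ n - (- y) ^ n = x * (\<Sum>i<n. (- y) ^ (n - Suc i) * (x - y) ^ i)"
    by (subst power_diff_sumr2) simp
  then have quot: "((x - y) ^ n - (- y) ^ n) / x = (\<Sum>i<n. (- y) ^ (n - Suc i) * (x - y) ^ i)"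
    using x0 by simp
  have sumR: "(\<Sum>i<k. (- y) ^ (n - Suc i) * (x - y) ^ i) \<in> ?R" for k
    using x y by (induction k) (auto intro!: in_sums)
  have "x - y = 1 / ?f" by (simp add: x_def)
  then have shift: "1 / ((?p * ?f) ^ n * x) = (1 / ?p) ^ n * ((x - y) ^ n / x)"
    by (simp add: power_mult_distrib power_one_over field_simps)
  have "(1 / ?p) ^ n * ((x - y) ^ n / x) - (1 / ?p) ^ n * (((x - y) ^ n - (- y) ^ n) / x) \<in> ?R"
    using n mult_in_sums[OF pR sumR[of n]] unfolding quot shift by (rule diff_in_sums)
  also have "(1 / ?p) ^ n * ((x - y) ^ n / x) - (1 / ?p) ^ n * (((x - y) ^ n - (- y) ^ n) / x)
      = (1 / ?p) ^ n * ((- y) ^ n / x)"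
    by (simp add: diff_divide_distrib right_diff_distrib)
  \<comment> \<open>Next the unit \<open>(- y) ^ n\<close> is cancelled, at the price of a further power of \<open>p\<close>.\<close>
  finally have "(1 / ?p) ^ n * ((- y) ^ n / x) * (- (1 / (?p ^ m * y))) ^ n \<in> ?R"
    by (rule mult_in_sums[OF _ power_in_sums[OF uminus_in_sums[OF m]]])
  also have "(1 / ?p) ^ n * ((- y) ^ n / x) * (- (1 / (?p ^ m * y))) ^ n
      = 1 / (?p ^ (n + m * n) * x)"
  proof -
    have "(- y) ^ n * (- (1 / (?p ^ m * y))) ^ n = (1 / ?p ^ m) ^ n"
      using y0 by (simp flip: power_mult_distrib)
    then have "(1 / ?p) ^ n * ((- y) ^ n / x) * (- (1 / (?p ^ m * y))) ^ n
      = (1 / ?p) ^ n * (1 / ?p ^ m) ^ n / x"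
      by (simp add: mult_ac)
    then show ?thesis
      by (simp add: power_add power_mult power_one_over)
  qed
  finally have "1 / (?p ^ (n + m * n) * x) \<in> ?R" .
  moreover have "x = to_fract q / ?p + (\<Sum>f\<leftarrow>f # fs. 1 / to_fract f)"
    by (simp add: x_def y_def)
  ultimately show ?case
    using x0 by metis
qed

text \<open>
  The reciprocals occurring here have positive valuation, hence so has their sum. The valuation is
  never introduced as a function of a fraction: comparing the degrees of numerator and denominator
  in any representation is enough, so no well-definedness has to be proved.
\<close>
lemma fraction_deg_less:
  assumes "0 \<notin> set fs" "\<forall>f\<in>set fs. 0 < deg f"
    and "to_fract a / to_fract b = (\<Sum>f\<leftarrow>fs. 1 / to_fract f)" "a \<noteq> 0" "b \<noteq> 0"
  shows "deg a < deg b"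
  using assms
proof (induction fs arbitrary: a b)
  case (Cons f fs)
  show ?case
  proof (cases "a * f = b")
    case True
    with Cons.prems show ?thesis by (auto simp: deg_mult)
  next
    case False
    have f: "f \<noteq> 0" "0 < deg f" using Cons.prems by auto
    have "to_fract (a * f - b) / to_fract (b * f) = to_fract a / to_fract b - 1 / to_fract f"
      using Cons.prems f by (simp add: field_simps)
    also have "\<dots> = (\<Sum>f\<leftarrow>fs. 1 / to_fract f)"
      using Cons.prems(3) by simp
    finally have "deg (a * f - b) < deg (b * f)"
      using Cons.IH[of "a * f - b" "b * f"] Cons.prems f False by simp
    moreover have "deg b < deg (b * f)"
      using Cons.prems f by (simp add: deg_mult)
    moreover have "deg (a * f) \<le> max (deg (a * f - b)) (deg b)"
      using deg_add_le[of "a * f - b" b] by simp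
    ultimately show ?thesis
      using Cons.prems f by (simp add: deg_mult)
  qed
qed simp

lemma nonunit_deg_less:
  assumes "to_fract a / to_fract b \<in> unit_fraction_sums" "a \<noteq> 0" "b \<noteq> 0"
    and nonunit: "to_fract b / to_fract a \<notin> unit_fraction_sums"
  shows "deg a < deg b"
proof -
  obtain fs where fs: "0 \<notin> set fs" "to_fract a / to_fract b = (\<Sum>f\<leftarrow>fs. 1 / to_fract f)"
    using assms(1) by (rule unit_fraction_sumsE)
  define gs where "gs = filter (\<lambda>f. 0 < deg f) fs"
  have gs: "0 \<notin> set gs" "\<forall>g\<in>set gs. 0 < deg g"
    using fs(1) by (auto simp: gs_def)
  obtain c where c: "(\<Sum>f\<leftarrow>filter (\<lambda>f. deg f = 0) fs. 1 / to_fract f) = to_fract c" "deg c = 0"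
    using fs(1) by (elim sum_units_deg_0[rotated 2]) auto
  have "(\<Sum>f\<leftarrow>fs. 1 / to_fract f) = to_fract c + (\<Sum>g\<leftarrow>gs. 1 / to_fract g)"
    unfolding c(1)[symmetric] gs_def by (induction fs) (auto simp: add_ac)
  with fs have eq: "to_fract a / to_fract b = to_fract c / to_fract 1 + (\<Sum>g\<leftarrow>gs. 1 / to_fract g)"
    by simp
  have cR: "to_fract c \<in> unit_fraction_sums"
    unfolding c(1)[symmetric] using fs(1) by (intro unit_fraction_sumsI) auto
  \<comment> \<open>A nonzero constant part would make the element a unit.\<close>
  have "c = 0"
  proof (rule ccontr)
    assume "c \<noteq> 0"
    then have "1 / (to_fract a / to_fract b) \<in> unit_fraction_sums"
      using reciprocal_of_sum_localized[of 1 c gs] gs c(2) cR unfolding eq by simp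
    with nonunit show False by simp
  qed
  with eq show ?thesis
    using fraction_deg_less[OF gs] assms(2,3) by simp
qed

text \<open>
  Degrees add up along products, so if a nonzero element splits into two nonunits, both of
  positive valuation, then each factor has a strictly smaller valuation than the product.
\<close>
theorem atomic_reciprocal_complement: "atomic (reciprocal_complement :: 'a fract ring)"
proof -
  let ?R = "reciprocal_complement :: 'a fract ring"
  have "\<exists>fs. set fs \<subseteq> carrier ?R \<and> (\<forall>f\<in>set fs. ring_irreducible\<^bsub>?R\<^esub> f) \<and>
        foldr (\<otimes>\<^bsub>?R\<^esub>) fs \<one>\<^bsub>?R\<^esub> = to_fract a / to_fract b"
    if "to_fract a / to_fract b \<in> carrier ?R" "to_fract a / to_fract b \<notin> Units ?R"
      "a \<noteq> 0" "b \<noteq> 0" for a b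
    using that
  proof (induction "deg b - deg a" arbitrary: a b rule: less_induct)
    case less
    let ?x = "to_fract a / to_fract b"
    show ?case
    proof (cases "ring_irreducible\<^bsub>?R\<^esub> ?x")
      case True
      with less.prems show ?thesis
        by (intro exI[of _ "[?x]"]) simp
    next
      case False
      then obtain y where y: "y \<in> carrier ?R" "y \<notin> Units ?R" "properfactor ?R y ?x"
        using less.prems by (auto simp: ring_irreducible_def irreducible_def)
      then obtain z where z: "z \<in> carrier ?R" "?x = y * z"
        by (auto simp: properfactor_def factor_def)
      have nz: "y \<noteq> 0" "z \<noteq> 0" using z(2) less.prems by auto
      have "z \<notin> Units ?R"
      proof
        assume "z \<in> Units ?R"
        then have "1 / z \<in> carrier ?R" "y = ?x * (1 / z)"
          using z(2) nz by (auto simp: Units_reciprocal_complement)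
        with y(3) show False
          by (auto simp: properfactor_def factor_def)
      qed
      obtain a1 b1 where 1: "y = to_fract a1 / to_fract b1" "b1 \<noteq> 0"
        by (cases y) (auto simp: Fract_conv_to_fract)
      obtain a2 b2 where 2: "z = to_fract a2 / to_fract b2" "b2 \<noteq> 0"
        by (cases z) (auto simp: Fract_conv_to_fract)
      have a: "a1 \<noteq> 0" "a2 \<noteq> 0" using 1 2 nz by auto
      have less1: "deg a1 < deg b1"
        using nonunit_deg_less[of a1 b1] y(1,2) 1 a nz by (auto simp: Units_reciprocal_complement)
      have less2: "deg a2 < deg b2"
        using nonunit_deg_less[of a2 b2] z(1) \<open>z \<notin> Units ?R\<close> 2 a nz
        by (auto simp: Units_reciprocal_complement)
      have "to_fract (a * (b1 * b2)) = to_fract (a1 * a2 * b)"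
        using z(2) 1 2 less.prems by (simp add: field_simps)
      then have "deg (a * (b1 * b2)) = deg (a1 * a2 * b)"
        by (simp only: to_fract_eq_iff)
      then have "deg a + deg b1 + deg b2 = deg a1 + deg a2 + deg b"
        using less.prems 1 2 a by (simp add: deg_mult)
      with less1 less2 have *: "deg b1 - deg a1 < deg b - deg a" "deg b2 - deg a2 < deg b - deg a"
        by linarith+
      obtain fs where fs: "set fs \<subseteq> carrier ?R" "\<forall>f\<in>set fs. ring_irreducible\<^bsub>?R\<^esub> f"
          "foldr (\<otimes>\<^bsub>?R\<^esub>) fs \<one>\<^bsub>?R\<^esub> = y"
        using less.hyps[OF *(1)] y(1,2) 1 a by metis
      obtain gs where gs: "set gs \<subseteq> carrier ?R" "\<forall>f\<in>set gs. ring_irreducible\<^bsub>?R\<^esub> f"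
          "foldr (\<otimes>\<^bsub>?R\<^esub>) gs \<one>\<^bsub>?R\<^esub> = z"
        using less.hyps[OF *(2)] z(1) \<open>z \<notin> Units ?R\<close> 2 a by metis
      have "foldr (*) (fs @ gs) 1 = foldr (*) fs 1 * foldr (*) gs (1 :: 'a fract)"
        by (induction fs) (auto simp: mult_ac)
      with fs gs z(2) show ?thesis
        by (intro exI[of _ "fs @ gs"]) auto
    qed
  qed
  note factorization = this
  show ?thesis
    unfolding atomic_def
  proof (intro ballI impI, elim conjE)
    fix x assume x: "x \<in> carrier ?R" "x \<noteq> \<zero>\<^bsub>?R\<^esub>" "x \<notin> Units ?R"
    obtain a b where "x = to_fract a / to_fract b" "b \<noteq> 0"
      by (cases x) (auto simp: Fract_conv_to_fract)
    moreover from this x(2) have "a \<noteq> 0" by auto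
    ultimately show "\<exists>fs. set fs \<subseteq> carrier ?R \<and> (\<forall>f\<in>set fs. ring_irreducible\<^bsub>?R\<^esub> f) \<and>
        foldr (\<otimes>\<^bsub>?R\<^esub>) fs \<one>\<^bsub>?R\<^esub> = x"
      using factorization[of a b] x by blast
  qed
qed

end


section \<open>The total degree of a multivariate polynomial\<close>

definition monomial_degree :: "('n::finite \<Rightarrow>\<^sub>0 nat) \<Rightarrow> nat" where
  "monomial_degree m = (\<Sum>i\<in>UNIV. Poly_Mapping.lookup m i)"

lemma monomial_degree_add: "monomial_degree (m + n) = monomial_degree m + monomial_degree n"
  by (simp add: monomial_degree_def lookup_add sum.distrib)

lemma monomial_degree_eq_0_iff: "monomial_degree m = 0 \<longleftrightarrow> m = 0"
  by (auto simp: monomial_degree_def intro: poly_mapping_eqI)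

text \<open>
  The ring homomorphism \<open>p(X\<^sub>1, \<dots>, X\<^sub>n) \<mapsto> p(t X\<^sub>1, \<dots>, t X\<^sub>n)\<close> into polynomials in \<open>t\<close>. The coefficient
  of \<open>t ^ d\<close> is the homogeneous component of degree \<open>d\<close>, so the degree in \<open>t\<close> is the total degree of
  \<open>p\<close>. In this form the total degree inherits its multiplicativity from univariate polynomials over
  a domain, without any choice of leading monomials.
\<close>
definition dilate :: "('n::finite, 'k::field) mpoly \<Rightarrow> ('n, 'k) mpoly poly" where
  "dilate p = (\<Sum>m\<in>Poly_Mapping.keys p.
     monom (Poly_Mapping.single m (Poly_Mapping.lookup p m)) (monomial_degree m))"

lemma lookup_coeff_dilate:
  "Poly_Mapping.lookup (coeff (dilate p) d) m =
    (Poly_Mapping.lookup p m when monomial_degree m = d)"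
proof -
  have "Poly_Mapping.lookup (coeff (dilate p) d) m =
    (\<Sum>l\<in>Poly_Mapping.keys p. if l = m then (Poly_Mapping.lookup p m when monomial_degree m = d) else 0)"
    unfolding dilate_def coeff_sum lookup_sum
    by (intro sum.cong) (auto simp: lookup_single when_def)
  then show ?thesis
    by (auto simp: in_keys_iff when_def)
qed

lemma dilate_add: "dilate (p + q) = dilate p + dilate q"
  by (intro poly_eqI poly_mapping_eqI) (simp add: lookup_coeff_dilate lookup_add when_add_distrib)

lemma dilate_0 [simp]: "dilate 0 = 0"
  by (simp add: dilate_def)

lemma dilate_sum: "dilate (sum p A) = (\<Sum>i\<in>A. dilate (p i))"
  by (induction A rule: infinite_finite_induct) (auto simp: dilate_add)

lemma dilate_single: "dilate (Poly_Mapping.single m c) = monom (Poly_Mapping.single m c) (monomial_degree m)"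
  by (simp add: dilate_def)

lemma sum_single_lookup:
  "(\<Sum>m\<in>Poly_Mapping.keys p. Poly_Mapping.single m (Poly_Mapping.lookup p m)) = p"
  by (rule poly_mapping_eqI) (auto simp: lookup_sum lookup_single when_def in_keys_iff)

lemma dilate_mult: "dilate (p * q) = dilate p * dilate q"
proof -
  let ?t = "\<lambda>p m. Poly_Mapping.single m (Poly_Mapping.lookup p m)"
  have "p * q = (\<Sum>m\<in>Poly_Mapping.keys p. ?t p m) * (\<Sum>n\<in>Poly_Mapping.keys q. ?t q n)"
    by (simp only: sum_single_lookup)
  also have "\<dots> = (\<Sum>m\<in>Poly_Mapping.keys p. \<Sum>n\<in>Poly_Mapping.keys q. ?t p m * ?t q n)"
    by (rule sum_product)
  finally have "dilate (p * q) =
      (\<Sum>m\<in>Poly_Mapping.keys p. \<Sum>n\<in>Poly_Mapping.keys q. dilate (?t p m * ?t q n))"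
    by (simp add: dilate_sum)
  also have "\<dots> = dilate p * dilate q"
    by (simp add: dilate_def[of p] dilate_def[of q] sum_product dilate_single mult_single mult_monom
        monomial_degree_add)
  finally show ?thesis .
qed

lemma dilate_eq_0_iff: "dilate p = 0 \<longleftrightarrow> p = 0"
proof
  assume "dilate p = 0"
  then have "Poly_Mapping.lookup p m = 0" for m
    using lookup_coeff_dilate[of p "monomial_degree m" m] by simp
  then show "p = 0" by (auto intro: poly_mapping_eqI)
qed simp

text \<open>
  A polynomial of total degree \<open>0\<close> is a constant, and the coefficients form a field.
\<close>
lemma degree_dilate_eq_0_imp_unit:
  assumes "p \<noteq> 0" "degree (dilate p) = 0"
  shows "p dvd 1"
proof -
  have "Poly_Mapping.lookup p m = 0" if "m \<noteq> 0" for m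
    using lookup_coeff_dilate[of p "monomial_degree m" m]
      coeff_eq_0[of "dilate p" "monomial_degree m"] monomial_degree_eq_0_iff[of m] that assms(2)
    by simp
  then have p: "p = Poly_Mapping.single 0 (Poly_Mapping.lookup p 0)"
    by (intro poly_mapping_eqI) (auto simp: lookup_single when_def)
  with assms(1) have "Poly_Mapping.lookup p 0 \<noteq> 0"
    by auto
  then have "p * Poly_Mapping.single 0 (inverse (Poly_Mapping.lookup p 0)) = 1"
    by (subst p) (simp add: mult_single)
  then show ?thesis by (metis dvd_triv_left)
qed

interpretation total_degree:
  degree_function "\<lambda>p :: ('n::{finite, linorder}, 'k::field) mpoly. degree (dilate p)"
proof
  fix p q :: "('n, 'k) mpoly"
  show "degree (dilate (p + q)) \<le> max (degree (dilate p)) (degree (dilate q))"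
    unfolding dilate_add by (rule degree_add_le_max)
  show "p \<noteq> 0 \<Longrightarrow> q \<noteq> 0 \<Longrightarrow>
      degree (dilate (p * q)) = degree (dilate p) + degree (dilate q)"
    unfolding dilate_mult by (rule degree_mult_eq) (simp_all add: dilate_eq_0_iff)
qed (rule degree_dilate_eq_0_imp_unit)

theorem theorem3p11:
  shows "atomic (reciprocal_complement :: ('n::{finite, linorder}, 'k::field) mpoly fract ring)"
  by (rule total_degree.atomic_reciprocal_complement)

end
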